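(* Let $w_1,w_2,w_3$ be any positive integers, let $y_1,y_2,y_3\in\mathbb{Z}_p$, and let $n\ge 0$ be an integer. Then the following six expressions are all equal: \begin{align*} &\sum_{k+l+m=n}\binom{n}{k,l,m}E_{k,\chi,\xi^{w_2w_3}}(w_1y_1)E_{l,\chi,\xi^{w_1w_3}}(w_2y_2)E_{m,\chi,\xi^{w_1w_2}}(w_3y_3)\,w_{1}^{l+m}w_{2}^{k+m}w_{3}^{k+l}\\ =&\sum_{k+l+m=n}\binom{n}{k,l,m}E_{k,\chi,\xi^{w_2w_3}}(w_1y_1)E_{l,\chi,\xi^{w_1w_2}}(w_3y_2)E_{m,\chi,\xi^{w_1w_3}}(w_2y_3)\,w_{1}^{l+m}w_{3}^{k+m}w_{2}^{k+l}\\ =&\sum_{k+l+m=n}\binom{n}{k,l,m}E_{k,\chi,\xi^{w_1w_3}}(w_2y_1)E_{l,\chi,\xi^{w_2w_3}}(w_1y_2)E_{m,\chi,\xi^{w_1w_2}}(w_3y_3)\,w_{2}^{l+m}w_{1}^{k+m}w_{3}^{k+l}\\ =&\sum_{k+l+m=n}\binom{n}{k,l,m}E_{k,\chi,\xi^{w_1w_3}}(w_2y_1)E_{l,\chi,\xi^{w_1w_2}}(w_3y_2)E_{m,\chi,\xi^{w_2w_3}}(w_1y_3)\,w_{2}^{l+m}w_{3}^{k+m}w_{1}^{k+l}\\ =&\sum_{k+l+m=n}\binom{n}{k,l,m}E_{k,\chi,\xi^{w_1w_2}}(w_3y_1)E_{l,\chi,\xi^{w_2w_3}}(w_1y_2)E_{m,\chi,\xi^{w_1w_3}}(w_2y_3)\,w_{3}^{l+m}w_{1}^{k+m}w_{2}^{k+l}\\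 =&\sum_{k+l+m=n}\binom{n}{k,l,m}E_{k,\chi,\xi^{w_1w_2}}(w_3y_1)E_{l,\chi,\xi^{w_1w_3}}(w_2y_2)E_{m,\chi,\xi^{w_2w_3}}(w_1y_3)\,w_{3}^{l+m}w_{2}^{k+m}w_{1}^{k+l}. \end{align*}
   Context: Let $p$ be a fixed odd prime, $\mathbb{Z}_p$ the $p$-adic integers, $\mathbb{C}_p$ the completion of an algebraic closure of $\mathbb{Q}_p$ with absolute value normalized by $|p|_p=1/p$. Let $\xi\in\mathbb{C}_p$ be a fixed ramified root of unity, i.e. $\xi^{p^s}=1$ for some positive integer $s$. Let $d$ be a fixed odd positive integer and $\chi$ a primitive Dirichlet character of conductor $d$, regarded as a function on the integers (periodic mod $d$, zero on integers not coprime to $d$) with values in $\mathbb{C}_p$ via a fixed embedding $\overline{\mathbb{Q}}\to\mathbb{C}_p$. For a ramified root of unity $\zeta$ (e.g. $\zeta=\xi^{w}$, $w$ a positive integer), the generalized twisted Euler polynomials $E_{n,\chi,\zeta}(x)$ attached to $\chi$ and $\zeta$ are the polynomials in $x$ defined by the generating function $$\frac{2e^{xt}}{\zeta^d e^{dt}+1}\sum_{a=0}^{d-1}(-1)^a\chi(a)\zeta^a e^{at}=\sum_{n=0}^{\infty}E_{n,\chi,\zeta}(x)\frac{t^n}{n!}$$ (equivalently, for $x\in\mathbb{Z}_p$ and $|t|_p<p^{-1/(p-1)}$, the left side equals the $p$-adic fermionic integral $\int_X\chi(z)\zeta^z e^{(x+z)t}d\mu_{-1}(z)$, where $X=\varprojlim\mathbb{Z}/dp^N\mathbb{Z}$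 and $\int_X f\,d\mu_{-1}=\lim_{N\to\infty}\sum_{j=0}^{dp^N-1}f(j)(-1)^j$). The sums are over nonnegative integers $k,l,m$ with $k+l+m=n$, and $\binom{n}{k,l,m}=\frac{n!}{k!\,l!\,m!}$. *)

theory Defs
  imports
    "HOL-Analysis.Analysis"
    "HOL-Computational_Algebra.Computational_Algebra"
    "HOL-Number_Theory.Cong"
begin

locale nonarch_abs =
  fixes v :: "'c::field_char_0 \<Rightarrow> real"
  assumes nonneg: "v x \<ge> 0"
    and eq_0_iff: "v x = 0 \<longleftrightarrow> x = 0"
    and mult: "v (x * y) = v x * v y"
    and ultrametric: "v (x + y) \<le> max (v x) (v y)"
begin

lemma v_1: "v 1 = 1"
  using mult[of 1 1] eq_0_iff[of 1] by simp

lemma v_minus: "v (- x) = v x"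
proof -
  have "v (-1) * v (-1) = 1"
    using mult[of "-1" "-1"] v_1 by simp
  then have "v (-1) = 1"
    using nonneg[of "-1"] by (metis abs_of_nonneg abs_square_eq_1 power2_eq_square)
  then show ?thesis
    using mult[of "-1" x] by simp
qed

lemma metric_space: "Metric_space UNIV (\<lambda>x y. v (x - y))"
proof
  fix x y z :: 'c
  show "0 \<le> v (x - y)" by (rule nonneg)
  show "v (x - y) = v (y - x)" using v_minus[of "x - y"] by simp
  show "v (x - y) = 0 \<longleftrightarrow> x = y" by (simp add: eq_0_iff)
  show "v (x - z) \<le> v (x - y) + v (y - z)"
    using ultrametric[of "x - y" "y - z"] nonneg[of "x - y"] nonneg[of "y - z"] by simp
qed

end

abbreviation abs_topology :: "('c::field_char_0 \<Rightarrow> real) \<Rightarrow> 'c topology" where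
  "abs_topology v \<equiv> Metric_space.mtopology UNIV (\<lambda>x y. v (x - y))"

text \<open>
  If \<open>v\<close> is complete and restricts to the \<open>p\<close>-adic absolute value on the rationals, the
  topological closure of the rationals is a completion of the rationals, i.e. the field of
  \<open>p\<close>-adic numbers inside \<open>'c\<close>.
\<close>

definition padic_numbers :: "('c::field_char_0 \<Rightarrow> real) \<Rightarrow> 'c set" where
  "padic_numbers v = abs_topology v closure_of \<rat>"

definition padic_integers :: "('c::field_char_0 \<Rightarrow> real) \<Rightarrow> 'c set" where
  "padic_integers v = {x \<in> padic_numbers v. v x \<le> 1}"

definition algebraic_elements :: "'c::field set \<Rightarrow> 'c set" where
  "algebraic_elements K = {x. \<exists>q. q \<noteq> 0 \<and> (\<forall>i. coeff q i \<in> K) \<and> poly q x = 0}"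

text \<open>
  \<open>'c\<close> with the absolute value \<open>v\<close> is the completion of an algebraic closure of the field of
  \<open>p\<close>-adic numbers: the elements algebraic over the \<open>p\<close>-adic numbers form an algebraically
  closed field, which is dense in the complete field \<open>'c\<close>. This determines \<open>('c, v)\<close> up to
  isometric isomorphism. A real normed field would not do here, since its norm is archimedean.
  The ultrametric inequality and \<open>norm_p\<close> force \<open>v\<close> to be the \<open>p\<close>-adic absolute value on
  the rationals.
\<close>

locale padic_complex_field = nonarch_abs v
  for p :: nat and v :: "'c::field_char_0 \<Rightarrow> real" +
  assumes prime_p: "prime p"
    and norm_p: "v (of_nat p) = 1 / real p"
    and complete: "Metric_space.mcomplete UNIV (\<lambda>x y. v (x - y))"
    and alg_closed:
      "\<And>q. degree q > 0 \<Longrightarrow> (\<forall>i. coeff q i \<in> algebraic_elements (padic_numbers v)) \<Longrightarrow>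
         \<exists>x \<in> algebraic_elements (padic_numbers v). poly q x = 0"
    and dense: "abs_topology v closure_of algebraic_elements (padic_numbers v) = UNIV"

definition ramified_root_of_unity :: "nat \<Rightarrow> 'c::field \<Rightarrow> bool" where
  "ramified_root_of_unity p \<xi> \<longleftrightarrow> (\<exists>s>0. \<xi> ^ (p ^ s) = 1)"

definition dirichlet_character :: "nat \<Rightarrow> (int \<Rightarrow> complex) \<Rightarrow> bool" where
  "dirichlet_character d chi \<longleftrightarrow> d > 0 \<and>
     (\<forall>a. chi (a + int d) = chi a) \<and>
     (\<forall>a b. chi (a * b) = chi a * chi b) \<and>
     (\<forall>a. chi a = 0 \<longleftrightarrow> \<not> coprime a (int d))"

definition conductor :: "nat \<Rightarrow> (int \<Rightarrow> complex) \<Rightarrow> nat" where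
  "conductor d chi = (LEAST f. f > 0 \<and> f dvd d \<and>
     (\<forall>a. coprime a (int d) \<and> [a = 1] (mod int f) \<longrightarrow> chi a = 1))"

definition primitive_character :: "nat \<Rightarrow> (int \<Rightarrow> complex) \<Rightarrow> bool" where
  "primitive_character d chi \<longleftrightarrow> dirichlet_character d chi \<and> conductor d chi = d"

text \<open>
  A field embedding of the algebraic numbers; it is automatically injective. Its values off the
  algebraic numbers are irrelevant, as the values of a Dirichlet character are algebraic.
\<close>

definition algebraic_embedding :: "(complex \<Rightarrow> 'c::field_char_0) \<Rightarrow> bool" where
  "algebraic_embedding \<iota> \<longleftrightarrow> \<iota> 1 = 1 \<and>
     (\<forall>x y. algebraic x \<and> algebraic y \<longrightarrow>
        \<iota> (x + y) = \<iota> x + \<iota> y \<and> \<iota> (x * y) = \<iota> x * \<iota> y)"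

text \<open>
  The generating function is a power series in \<open>t\<close> with coefficients in \<open>'c[x]\<close>. Its factor
  free of \<open>x\<close> is formed over the field \<open>'c\<close>, where the denominator is a unit as soon as
  \<open>\<zeta> ^ d \<noteq> -1\<close>. This holds for every root of unity \<open>\<zeta>\<close> of odd order.
\<close>

definition twisted_euler_series :: "nat \<Rightarrow> (int \<Rightarrow> 'c) \<Rightarrow> 'c \<Rightarrow> 'c::field_char_0 fps" where
  "twisted_euler_series d chi \<zeta> =
     2 / (fps_const (\<zeta> ^ d) * fps_exp (of_nat d) + 1) *
     (\<Sum>a<d. fps_const ((-1) ^ a * chi (int a) * \<zeta> ^ a) * fps_exp (of_nat a))"

lemma twisted_euler_series_mult_denominator:
  assumes "\<zeta> ^ d \<noteq> - 1"
  shows "(fps_const (\<zeta> ^ d) * fps_exp (of_nat d) + 1) * twisted_euler_series d chi \<zeta> =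
     2 * (\<Sum>a<d. fps_const ((-1) ^ a * chi (int a) * \<zeta> ^ a) * fps_exp (of_nat a))"
proof -
  define D :: "'a fps" where "D = fps_const (\<zeta> ^ d) * fps_exp (of_nat d) + 1"
  have unit: "fps_nth D 0 \<noteq> 0"
    using assms by (simp add: D_def add_eq_0_iff2)
  have "D * (2 / D) = 2 * (D * inverse D)"
    unfolding fps_divide_unit[OF unit] by (rule mult.left_commute)
  also have "\<dots> = 2"
    unfolding inverse_mult_eq_1'[OF unit] by (rule mult_1_right)
  finally have "D * (2 / D) = 2" .
  then show ?thesis
    unfolding twisted_euler_series_def D_def[symmetric] by (simp only: mult.assoc[symmetric])
qed

definition fps_exp_indet :: "'c::field_char_0 poly fps" where
  "fps_exp_indet = Abs_fps (\<lambda>k. monom (1 / fact k) k)"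

definition twisted_euler_gf ::
    "nat \<Rightarrow> (int \<Rightarrow> 'c) \<Rightarrow> 'c \<Rightarrow> 'c::field_char_0 poly fps" where
  "twisted_euler_gf d chi \<zeta> =
     fps_exp_indet * Abs_fps (\<lambda>k. [:fps_nth (twisted_euler_series d chi \<zeta>) k:])"

definition twisted_euler_poly ::
    "nat \<Rightarrow> (int \<Rightarrow> 'c) \<Rightarrow> 'c \<Rightarrow> nat \<Rightarrow> 'c::field_char_0 poly" where
  "twisted_euler_poly d chi \<zeta> n = smult (fact n) (fps_nth (twisted_euler_gf d chi \<zeta>) n)"

lemma poly_twisted_euler_poly:
  "poly (twisted_euler_poly d chi \<zeta> n) x =
     fact n * fps_nth (fps_exp x * twisted_euler_series d chi \<zeta>) n"
  by (auto simp: twisted_euler_poly_def twisted_euler_gf_def fps_exp_indet_def fps_mult_nth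
      poly_sum poly_monom intro!: sum.cong)

lemma twisted_euler_poly_generating_function:
  "Abs_fps (\<lambda>n. poly (twisted_euler_poly d chi \<zeta> n) x / fact n) =
     fps_exp x * twisted_euler_series d chi \<zeta>"
  by (simp add: fps_eq_iff poly_twisted_euler_poly)

definition trinomial :: "nat \<Rightarrow> nat \<Rightarrow> nat \<Rightarrow> nat \<Rightarrow> 'c::field_char_0" where
  "trinomial n k l m = fact n / (fact k * fact l * fact m)"

end

theory Submission
  imports Defs
begin

text \<open>
  With \<open>T \<zeta>\<close> the generating function at \<open>x = 0\<close>, the sum for weights \<open>a, b, c\<close> is \<open>n!\<close> times the
  coefficient of \<open>t ^ n\<close> in \<open>exp (abc(y1 + y2 + y3)t) (T \<zeta>1)(bct) (T \<zeta>2)(act) (T \<zeta>3)(abt)\<close>,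
  where \<open>\<zeta>1 = \<xi> ^ bc\<close>, \<open>\<zeta>2 = \<xi> ^ ac\<close>, \<open>\<zeta>3 = \<xi> ^ ab\<close>. This product is symmetric in \<open>a, b, c\<close>.
\<close>

lemma fps_mult3_nth:
  fixes f g h :: "'a::comm_semiring_0 fps"
  shows "fps_nth (f * g * h) n =
    (\<Sum>(k, l, m) \<in> {(k, l, m). k + l + m = n}. fps_nth f k * fps_nth g l * fps_nth h m)"
proof -
  have "fps_nth (f * g * h) n =
      (\<Sum>i\<le>n. \<Sum>j\<le>i. fps_nth f j * fps_nth g (i - j) * fps_nth h (n - i))"
    by (simp add: fps_mult_nth sum_distrib_right atLeast0AtMost)
  also have "\<dots> = (\<Sum>(i, j) \<in> (SIGMA i:{..n}. {..i}).
      fps_nth f j * fps_nth g (i - j) * fps_nth h (n - i))"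
    by (simp add: sum.Sigma)
  also have "\<dots> = (\<Sum>(k, l, m) \<in> {(k, l, m). k + l + m = n}.
      fps_nth f k * fps_nth g l * fps_nth h m)"
    \<comment> \<open>Here \<open>i = k + l\<close> is the degree contributed by
      \<open>f * g\<close>, and \<open>j = k\<close> the part of it due to \<open>f\<close>.\<close>
    by (rule sum.reindex_bij_witness[of _ "\<lambda>(k, l, m). (k + l, k)" "\<lambda>(i, j). (j, i - j, n - i)"])
      auto
  finally show ?thesis .
qed

text \<open>Replacing \<open>t\<close> by \<open>r t\<close> multiplies the coefficient of
  \<open>t ^ k\<close> by \<open>r ^ k\<close>; this produces the weight powers, with
  \<open>r\<close> a product of two weights.\<close>

lemma twisted_euler_poly_rescaled_gf:
  fixes r :: "'c::field_char_0"
  shows "fps_nth (fps_exp (r * x) * (twisted_euler_series d chi \<zeta> oo (fps_const r * fps_X))) k =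
    r ^ k * poly (twisted_euler_poly d chi \<zeta> k) x / fact k"
proof -
  have "fps_exp (r * x) * (twisted_euler_series d chi \<zeta> oo (fps_const r * fps_X)) =
      (fps_exp x * twisted_euler_series d chi \<zeta>) oo (fps_const r * fps_X)"
    \<comment> \<open>Substitution respects products because \<open>fps_const r * fps_X\<close> has
      zero constant term.\<close>
    by (simp add: fps_compose_mult_distrib fps_exp_compose_linear)
  then show ?thesis
    by (simp add: fps_compose_linear poly_twisted_euler_poly)
qed

text \<open>The weight powers regroup as \<open>(b * c) ^ k * (a * c) ^ l * (a * b) ^ m\<close>, one
  rescaling per factor. The roots \<open>\<zeta>1\<close>, \<open>\<zeta>2\<close>,
  \<open>\<zeta>3\<close> stay arbitrary here.\<close>

lemma sum_trinomial_twisted_euler_poly: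
  fixes a b c :: "'c::field_char_0"
  shows "(\<Sum>(k, l, m) \<in> {(k, l, m). k + l + m = n}. trinomial n k l m *
      poly (twisted_euler_poly d chi \<zeta>1 k) (a * y1) *
      poly (twisted_euler_poly d chi \<zeta>2 l) (b * y2) *
      poly (twisted_euler_poly d chi \<zeta>3 m) (c * y3) *
      a ^ (l + m) * b ^ (k + m) * c ^ (k + l)) =
    fact n * fps_nth (fps_exp (a * b * c * (y1 + y2 + y3)) *
      ((twisted_euler_series d chi \<zeta>1 oo (fps_const (b * c) * fps_X)) *
       (twisted_euler_series d chi \<zeta>2 oo (fps_const (a * c) * fps_X)) *
       (twisted_euler_series d chi \<zeta>3 oo (fps_const (a * b) * fps_X)))) n"
proof -
  let ?G = "\<lambda>\<zeta> r x. fps_exp (r * x) * (twisted_euler_series d chi \<zeta> oo (fps_const r * fps_X))"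
  \<comment> \<open>Each rescaling supplies the two weights missing from its argument, so all three
    exponents carry the common factor \<open>a * b * c\<close>.\<close>
  have "fps_exp (a * b * c * (y1 + y2 + y3)) =
      fps_exp (b * c * (a * y1)) * fps_exp (a * c * (b * y2)) * fps_exp (a * b * (c * y3))"
    by (simp add: fps_exp_add_mult[symmetric] algebra_simps)
  then have "fps_exp (a * b * c * (y1 + y2 + y3)) *
      ((twisted_euler_series d chi \<zeta>1 oo (fps_const (b * c) * fps_X)) *
       (twisted_euler_series d chi \<zeta>2 oo (fps_const (a * c) * fps_X)) *
       (twisted_euler_series d chi \<zeta>3 oo (fps_const (a * b) * fps_X))) =
      ?G \<zeta>1 (b * c) (a * y1) * ?G \<zeta>2 (a * c) (b * y2) * ?G \<zeta>3 (a * b) (c * y3)"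
    by (simp only: mult_ac)
  then show ?thesis
    \<comment> \<open>The outer \<open>fact n\<close> and the three denominators from the rescaled
      series form \<open>trinomial n k l m\<close>.\<close>
    by (simp only: fps_mult3_nth twisted_euler_poly_rescaled_gf sum_distrib_left, intro sum.cong)
      (auto simp: trinomial_def power_add power_mult_distrib mult_ac)
qed

theorem theorem1:
  fixes p d n w1 w2 w3 :: nat
    and v :: "'c::field_char_0 \<Rightarrow> real"
    and \<xi> y1 y2 y3 :: 'c
    and chi :: "int \<Rightarrow> complex"
    and \<iota> :: "complex \<Rightarrow> 'c"
  assumes "prime p" and "odd p"
    and "padic_complex_field p v"
    and "ramified_root_of_unity p \<xi>"
    and "d > 0" and "odd d"
    and "primitive_character d chi"
    and "algebraic_embedding \<iota>"
    and "w1 > 0" and "w2 > 0" and "w3 > 0"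
    and "y1 \<in> padic_integers v" and "y2 \<in> padic_integers v" and "y3 \<in> padic_integers v"
  shows
    "let E = (\<lambda>j \<zeta> x. poly (twisted_euler_poly d (\<lambda>a. \<iota> (chi a)) \<zeta> j) x);
       I = {(k, l, m). k + l + m = n};
       S1 = (\<Sum>(k, l, m) \<in> I. trinomial n k l m *
          E k (\<xi> ^ (w2 * w3)) (of_nat w1 * y1) *
          E l (\<xi> ^ (w1 * w3)) (of_nat w2 * y2) *
          E m (\<xi> ^ (w1 * w2)) (of_nat w3 * y3) *
          of_nat w1 ^ (l + m) * of_nat w2 ^ (k + m) * of_nat w3 ^ (k + l));
       S2 = (\<Sum>(k, l, m) \<in> I. trinomial n k l m *
          E k (\<xi> ^ (w2 * w3)) (of_nat w1 * y1) *
          E l (\<xi> ^ (w1 * w2)) (of_nat w3 * y2) *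
          E m (\<xi> ^ (w1 * w3)) (of_nat w2 * y3) *
          of_nat w1 ^ (l + m) * of_nat w3 ^ (k + m) * of_nat w2 ^ (k + l));
       S3 = (\<Sum>(k, l, m) \<in> I. trinomial n k l m *
          E k (\<xi> ^ (w1 * w3)) (of_nat w2 * y1) *
          E l (\<xi> ^ (w2 * w3)) (of_nat w1 * y2) *
          E m (\<xi> ^ (w1 * w2)) (of_nat w3 * y3) *
          of_nat w2 ^ (l + m) * of_nat w1 ^ (k + m) * of_nat w3 ^ (k + l));
       S4 = (\<Sum>(k, l, m) \<in> I. trinomial n k l m *
          E k (\<xi> ^ (w1 * w3)) (of_nat w2 * y1) *
          E l (\<xi> ^ (w1 * w2)) (of_nat w3 * y2) *
          E m (\<xi> ^ (w2 * w3)) (of_nat w1 * y3) *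
          of_nat w2 ^ (l + m) * of_nat w3 ^ (k + m) * of_nat w1 ^ (k + l));
       S5 = (\<Sum>(k, l, m) \<in> I. trinomial n k l m *
          E k (\<xi> ^ (w1 * w2)) (of_nat w3 * y1) *
          E l (\<xi> ^ (w2 * w3)) (of_nat w1 * y2) *
          E m (\<xi> ^ (w1 * w3)) (of_nat w2 * y3) *
          of_nat w3 ^ (l + m) * of_nat w1 ^ (k + m) * of_nat w2 ^ (k + l));
       S6 = (\<Sum>(k, l, m) \<in> I. trinomial n k l m *
          E k (\<xi> ^ (w1 * w2)) (of_nat w3 * y1) *
          E l (\<xi> ^ (w1 * w3)) (of_nat w2 * y2) *
          E m (\<xi> ^ (w2 * w3)) (of_nat w1 * y3) *
          of_nat w3 ^ (l + m) * of_nat w2 ^ (k + m) * of_nat w1 ^ (k + l))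
     in S1 = S2 \<and> S2 = S3 \<and> S3 = S4 \<and> S4 = S5 \<and> S5 = S6"
  \<comment> \<open>The root \<open>\<xi> ^ (w2 * w3)\<close> always occurs with the rescaling by
    \<open>w2 * w3\<close>, and likewise for the other pairs, while \<open>y1 + y2 + y3\<close> is
    the same in all six; so the products differ only in the order of factors.\<close>
  unfolding Let_def sum_trinomial_twisted_euler_poly
  by (simp add: mult_ac add_ac)

end
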